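(* Let $n\ge1$ and $a,b>0$. There exists a relative symplectic embedding $$e:B^{2n}\left(2\sqrt{\tfrac{ab}{\pi}}\right)\to P_L(a,b),$$ i.e. an embedding with $e^*\omega_{st}=\omega_{st}$ and such that the preimage under $e$ of $D_q^n(a)=\{(q,0)\mid\|q\|<a\}$ is the real part $B^n\left(2\sqrt{ab/\pi}\right)\times\{0\}$ of the ball.
   Context: $\mathbb{R}^{2n}=\mathbb{R}^n\times\mathbb{R}^n$ with coordinates $(q,p)$ and $\omega_{st}=\sum dq_i\wedge dp_i$. $B^{m}(r)$ is the standard open ball of radius $r$ centered at the origin of $\mathbb{R}^m$. $P_L(a,b)=P_L^{2n}(a,b)=\{(q,p)\in\mathbb{R}^n\times\mathbb{R}^n\mid\|q\|<a,\ \|p\|<b\}$ is the Lagrangian bi-disc. *)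

theory Defs
  imports "HOL-Analysis.Analysis"
begin

text \<open>
  The space \<open>\<real>\<^sup>2\<^sup>n\<close> with coordinates \<open>(q, p)\<close> is the type \<^typ>\<open>(real ^ 'n) \<times> (real ^ 'n)\<close>, whose
  product norm is the Euclidean norm. Open balls are the library's \<^const>\<open>ball\<close>.
\<close>

primrec Ck_on :: "nat \<Rightarrow> 'a::euclidean_space set \<Rightarrow> ('a \<Rightarrow> 'b::euclidean_space) \<Rightarrow> bool" where
  "Ck_on 0 U f \<longleftrightarrow> continuous_on U f"
| "Ck_on (Suc k) U f \<longleftrightarrow>
     (\<forall>x\<in>U. f differentiable (at x)) \<and>
     (\<forall>v. Ck_on k U (\<lambda>x. frechet_derivative f (at x) v))"

text \<open>Meaningful only for open \<open>U\<close>, since derivatives are taken at \<open>x\<close> in the whole space.\<close>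

definition smooth_on :: "'a::euclidean_space set \<Rightarrow> ('a \<Rightarrow> 'b::euclidean_space) \<Rightarrow> bool" where
  "smooth_on U f \<longleftrightarrow> (\<forall>k. Ck_on k U f)"

definition smooth_embedding ::
  "'a::euclidean_space set \<Rightarrow> 'b::euclidean_space set \<Rightarrow> ('a \<Rightarrow> 'b) \<Rightarrow> bool" where
  "smooth_embedding U V f \<longleftrightarrow>
     open U \<and> open V \<and> f ` U \<subseteq> V \<and> smooth_on U f \<and>
     (\<forall>x\<in>U. inj (frechet_derivative f (at x))) \<and>
     (\<exists>g. homeomorphism U (f ` U) f g)"

definition omega_st :: "(real ^ 'n) \<times> (real ^ 'n) \<Rightarrow> (real ^ 'n) \<times> (real ^ 'n) \<Rightarrow> real" where
  "omega_st u v = (\<Sum>i\<in>UNIV. fst u $ i * snd v $ i - fst v $ i * snd u $ i)"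

text \<open>
  A 2-form is given by its value at each point as a function of two tangent vectors. The form
  \<open>\<Sum> dq\<^sub>i \<and> dp\<^sub>i\<close> is constant in the point, with \<open>(\<alpha> \<and> \<beta>)(u, v) = \<alpha>(u) \<beta>(v) - \<alpha>(v) \<beta>(u)\<close>.
\<close>

definition pullback2 ::
  "('a::euclidean_space \<Rightarrow> 'b::euclidean_space) \<Rightarrow> ('b \<Rightarrow> 'b \<Rightarrow> 'b \<Rightarrow> real) \<Rightarrow> ('a \<Rightarrow> 'a \<Rightarrow> 'a \<Rightarrow> real)"
  where
  "pullback2 f \<omega> x u v =
     \<omega> (f x) (frechet_derivative f (at x) u) (frechet_derivative f (at x) v)"

definition symplectic_embedding ::
  "((real ^ 'n) \<times> (real ^ 'n)) set \<Rightarrow> ((real ^ 'n) \<times> (real ^ 'n)) set \<Rightarrow>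
   ((real ^ 'n) \<times> (real ^ 'n) \<Rightarrow> (real ^ 'n) \<times> (real ^ 'n)) \<Rightarrow> bool" where
  "symplectic_embedding U V e \<longleftrightarrow>
     smooth_embedding U V e \<and>
     (\<forall>x\<in>U. pullback2 e (\<lambda>_. omega_st) x = omega_st)"

text \<open>
  Relative to subsets \<open>A\<close> of \<open>U\<close> and \<open>L\<close> of \<open>V\<close>: the preimage of \<open>L\<close> under the map
  \<open>e : U \<rightarrow> V\<close> is \<open>A\<close>. The values of the total function \<open>e\<close> outside \<open>U\<close> are irrelevant.
\<close>

definition relative_symplectic_embedding ::
  "((real ^ 'n) \<times> (real ^ 'n)) set \<Rightarrow> ((real ^ 'n) \<times> (real ^ 'n)) set \<Rightarrow>
   ((real ^ 'n) \<times> (real ^ 'n)) set \<Rightarrow> ((real ^ 'n) \<times> (real ^ 'n)) set \<Rightarrow>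
   ((real ^ 'n) \<times> (real ^ 'n) \<Rightarrow> (real ^ 'n) \<times> (real ^ 'n)) \<Rightarrow> bool" where
  "relative_symplectic_embedding U A V L e \<longleftrightarrow>
     symplectic_embedding U V e \<and> {x \<in> U. e x \<in> L} = A"

definition lagrangian_bidisc :: "real \<Rightarrow> real \<Rightarrow> ((real ^ 'n) \<times> (real ^ 'n)) set" where
  "lagrangian_bidisc a b = {(q, p). norm q < a \<and> norm p < b}"

definition disc_q :: "real \<Rightarrow> ((real ^ 'n) \<times> (real ^ 'n)) set" where
  "disc_q a = {(q, 0) | q. norm q < a}"

end

(*
  Let F be the radial function with F(0) = 0 and F'(t) = sqrt (R^2 - t^2) / b; then F(R) = a exactly for
  R = 2 sqrt (a b / pi). The embedding is the cotangent lift (q, p) |-> (phi q, (D phi q)^-T p) of the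
  radial map phi q = F(|q|) q / |q|. It preserves p = 0 and has |phi q| < F(R) = a. The singular values
  of D phi are F'(t) and F(t) / t, and concavity of F makes F' the smaller one, so that on the ball
  |(D phi)^-T p| <= |p| / F'(|q|) < b. For smoothness at the origin write phi q = G(|q|^2) q with
  G(s) = (integral over t in [0, 1] of sqrt (R^2 - s t^2)) / b.
*)
theory Submission
  imports Defs
begin

section \<open>Calculus of \<open>Ck_on\<close>\<close>

text \<open>A derivative at a point of an open set depends only on nearby values, so agreement on
  \<open>U\<close> passes to the Frechet derivatives and the induction can continue with
  them.\<close>

lemma Ck_on_cong:
  assumes "open U" "\<And>x. x \<in> U \<Longrightarrow> f x = g x" "Ck_on k U f"
  shows "Ck_on k U g"
  using assms(2,3)
proof (induction k arbitrary: f g)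
  case 0
  then show ?case by (metis Ck_on.simps(1) continuous_on_cong)
next
  case (Suc k)
  have der: "(g has_derivative frechet_derivative f (at x)) (at x)" if "x \<in> U" for x
    using Suc.prems that assms(1)
    by (metis Ck_on.simps(2) frechet_derivative_works has_derivative_transform_within_open)
  have "Ck_on k U (\<lambda>x. frechet_derivative g (at x) v)" for v
  proof (rule Suc.IH)
    show "frechet_derivative f (at x) v = frechet_derivative g (at x) v" if "x \<in> U" for x
      using frechet_derivative_at[OF der[OF that]] by simp
    show "Ck_on k U (\<lambda>x. frechet_derivative f (at x) v)"
      using Suc.prems by simp
  qed
  then show ?case using der by (auto simp: differentiable_def)
qed

text \<open>Lets any explicit derivative stand in for \<open>frechet_derivative\<close>. The closure
  properties below then reduce to a differentiation rule and the induction hypothesis.\<close>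

lemma Ck_on_SucI:
  assumes "open U" "\<And>x. x \<in> U \<Longrightarrow> (f has_derivative f' x) (at x)"
    and "\<And>v. Ck_on k U (\<lambda>x. f' x v)"
  shows "Ck_on (Suc k) U f"
proof -
  have "Ck_on k U (\<lambda>x. frechet_derivative f (at x) v)" for v
    by (rule Ck_on_cong[OF assms(1) _ assms(3)[of v]])
      (use frechet_derivative_at[OF assms(2)] in auto)
  then show ?thesis using assms(2) by (auto simp: differentiable_def)
qed

lemma Ck_on_SucD:
  assumes "Ck_on (Suc k) U f"
  shows "x \<in> U \<Longrightarrow> (f has_derivative frechet_derivative f (at x)) (at x)"
    and "Ck_on k U (\<lambda>x. frechet_derivative f (at x) v)"
  using assms frechet_derivative_works by auto

lemma Ck_on_Suc_imp: "Ck_on (Suc k) U f \<Longrightarrow> Ck_on k U f"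
proof (induction k arbitrary: f)
  case 0
  then show ?case
    by (auto intro!: continuous_at_imp_continuous_on differentiable_imp_continuous_within)
next
  case (Suc k)
  then show ?case by (metis Ck_on.simps(2))
qed

lemma Ck_on_const: "Ck_on k U (\<lambda>x. c)"
  by (induction k arbitrary: c) (auto simp: frechet_derivative_const)

lemma Ck_on_bounded_linear:
  assumes "open U" "bounded_linear L"
  shows "Ck_on k U L"
proof (cases k)
  case 0
  then show ?thesis using assms by (simp add: linear_continuous_on)
next
  case (Suc m)
  then show ?thesis
    using assms by (auto intro!: Ck_on_SucI[where f' = "\<lambda>x. L"] Ck_on_const bounded_linear_imp_has_derivative
      simp del: Ck_on.simps)
qed

lemma Ck_on_bounded_linear_compose:
  assumes "open U" "bounded_linear L" "Ck_on k U f"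
  shows "Ck_on k U (\<lambda>x. L (f x))"
  using assms(3)
proof (induction k arbitrary: f)
  case 0
  then show ?case using assms(2) by (simp add: bounded_linear.continuous_on)
next
  case (Suc k)
  note f = Ck_on_SucD[OF Suc.prems]
  show ?case
    by (rule Ck_on_SucI[OF assms(1) bounded_linear.has_derivative[OF assms(2) f(1)] Suc.IH[OF f(2)]])
qed

lemma Ck_on_add:
  assumes "open U" "Ck_on k U f" "Ck_on k U g"
  shows "Ck_on k U (\<lambda>x. f x + g x)"
  using assms(2,3)
proof (induction k arbitrary: f g)
  case 0
  then show ?case by (simp add: continuous_on_add)
next
  case (Suc k)
  note f = Ck_on_SucD[OF Suc.prems(1)] and g = Ck_on_SucD[OF Suc.prems(2)]
  show ?case
    by (rule Ck_on_SucI[OF assms(1) has_derivative_add[OF f(1) g(1)] Suc.IH[OF f(2) g(2)]])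
qed

lemma Ck_on_diff:
  assumes "open U" "Ck_on k U f" "Ck_on k U g"
  shows "Ck_on k U (\<lambda>x. f x - g x)"
  using Ck_on_add[OF assms(1,2) Ck_on_bounded_linear_compose[OF assms(1) bounded_linear_minus[OF bounded_linear_ident] assms(3)]]
  by simp

lemma Ck_on_Pair:
  assumes "open U" "Ck_on k U f" "Ck_on k U g"
  shows "Ck_on k U (\<lambda>x. (f x, g x))"
proof -
  have "bounded_linear (\<lambda>y. (y, 0))" "bounded_linear (\<lambda>y. (0, y))"
    by (auto intro!: bounded_linear_Pair bounded_linear_ident bounded_linear_zero)
  then show ?thesis
    using Ck_on_add[OF assms(1) Ck_on_bounded_linear_compose[OF assms(1) _ assms(2)]
        Ck_on_bounded_linear_compose[OF assms(1) _ assms(3)]]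
    by fastforce
qed

lemma Ck_on_bounded_bilinear:
  fixes prod :: "'b::euclidean_space \<Rightarrow> 'c::euclidean_space \<Rightarrow> 'd::euclidean_space"
  assumes "open U" "bounded_bilinear prod" "Ck_on k U f" "Ck_on k U g"
  shows "Ck_on k U (\<lambda>x. prod (f x) (g x))"
  using assms(3,4)
proof (induction k arbitrary: f g)
  case 0
  then show ?case by (simp add: bounded_bilinear.continuous_on[OF assms(2)])
next
  case (Suc k)
  note f = Ck_on_SucD[OF Suc.prems(1)] and g = Ck_on_SucD[OF Suc.prems(2)]
  \<comment> \<open>Each summand of the product rule pairs one derivative with one undifferentiated
    factor; the latter has an order to spare and is lowered to \<open>k\<close>.\<close>
  note IH = Suc.IH[OF Ck_on_Suc_imp[OF Suc.prems(1)] g(2)] Suc.IH[OF f(2) Ck_on_Suc_imp[OF Suc.prems(2)]]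
  show ?case
    by (rule Ck_on_SucI[OF assms(1) bounded_bilinear.FDERIV[OF assms(2) f(1) g(1)]
          Ck_on_add[OF assms(1) IH]])
qed

lemmas Ck_on_mult = Ck_on_bounded_bilinear[OF _ bounded_bilinear_mult]
  and Ck_on_scaleR = Ck_on_bounded_bilinear[OF _ bounded_bilinear_scaleR]
  and Ck_on_inner = Ck_on_bounded_bilinear[OF _ bounded_bilinear_inner]

text \<open>Carrying the whole sequence of derivatives closes the induction: differentiating
  \<open>D n\<close> after \<open>f\<close> gives \<open>D (Suc n)\<close> after \<open>f\<close>
  times the derivative of \<open>f\<close>, so \<open>n\<close> must stay arbitrary.\<close>

lemma Ck_on_compose_real:
  fixes D :: "nat \<Rightarrow> real \<Rightarrow> real"
  assumes "open U" "Ck_on k U f" "\<And>x. x \<in> U \<Longrightarrow> f x \<in> T"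
    and D: "\<And>n s. s \<in> T \<Longrightarrow> (D n has_real_derivative D (Suc n) s) (at s)"
  shows "Ck_on k U (\<lambda>x. D n (f x))"
  using assms(2)
proof (induction k arbitrary: n)
  case 0
  have "continuous_on T (D n)"
    using D by (meson DERIV_isCont continuous_at_imp_continuous_on)
  then show ?case
    using 0 assms(3) by (auto intro: continuous_on_compose2)
next
  case (Suc k)
  note f = Ck_on_SucD[OF Suc.prems]
  have "((\<lambda>x. D n (f x)) has_derivative (\<lambda>v. D (Suc n) (f x) * frechet_derivative f (at x) v)) (at x)"
    if "x \<in> U" for x
    using has_derivative_compose[OF f(1)[OF that] D[OF assms(3)[OF that], unfolded has_field_derivative_def]] .
  from Ck_on_SucI[OF assms(1) this Ck_on_mult[OF assms(1) Suc.IH[OF Ck_on_Suc_imp[OF Suc.prems]] f(2)]]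
  show ?case .
qed

section \<open>Derivatives of real powers, and reciprocals\<close>

text \<open>The \<open>n\<close>-th derivative of \<open>x powr \<alpha>\<close> for positive
  \<open>x\<close>; the product is the falling factorial of \<alpha>.\<close>

definition powr_deriv :: "real \<Rightarrow> nat \<Rightarrow> real \<Rightarrow> real" where
  "powr_deriv \<alpha> n x = (\<Prod>i<n. \<alpha> - real i) * x powr (\<alpha> - real n)"

lemma powr_deriv_has_derivative:
  assumes "x > 0"
  shows "(powr_deriv \<alpha> n has_real_derivative powr_deriv \<alpha> (Suc n) x) (at x)"
  unfolding powr_deriv_def
  by (rule derivative_eq_intros refl | use assms in \<open>simp add: algebra_simps\<close>)+

lemma Ck_on_inverse:
  fixes f :: "'a::euclidean_space \<Rightarrow> real"
  assumes "open U" "Ck_on k U f" "\<And>x. x \<in> U \<Longrightarrow> f x > 0"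
  shows "Ck_on k U (\<lambda>x. inverse (f x))"
proof (rule Ck_on_cong[OF assms(1)])
  show "Ck_on k U (\<lambda>x. powr_deriv (- 1) 0 (f x))"
    by (rule Ck_on_compose_real[OF assms(1,2), where T = "{0<..}"])
      (use assms(3) powr_deriv_has_derivative in auto)
  show "powr_deriv (- 1) 0 (f x) = inverse (f x)" if "x \<in> U" for x
    using assms(3)[OF that] by (simp add: powr_deriv_def powr_minus)
qed

section \<open>Cotangent lifts of radial maps\<close>

text \<open>Here \<open>D n\<close> is the \<open>n\<close>-th derivative of G, where the radial map
  is phi q = G(|q|^2) q. With s = |q|^2, \<open>D 0 s\<close> and
  \<open>D 0 s + 2 * s * D 1 s\<close> are its tangential and radial singular values. Negative
  \<open>s\<close> are included so that s = 0, the centre, is an interior point.\<close>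

locale radial_map =
  fixes D :: "nat \<Rightarrow> real \<Rightarrow> real" and r :: real
  assumes deriv: "s < r\<^sup>2 \<Longrightarrow> (D n has_real_derivative D (Suc n) s) (at s)"
    and r_pos: "r > 0"
    and D0_pos: "s < r\<^sup>2 \<Longrightarrow> D 0 s > 0"
    and speed_pos: "s < r\<^sup>2 \<Longrightarrow> D 0 s + 2 * s * D 1 s > 0"
begin

text \<open>The Jacobian is a multiple of the identity plus a rank-one term in \<open>q\<close>, and
  is symmetric. The second component is therefore its inverse applied to \<open>p\<close>, in
  Sherman-Morrison form.\<close>

definition lift :: "'a::euclidean_space \<times> 'a \<Rightarrow> 'a \<times> 'a" where
  "lift x = (let q = fst x; p = snd x; s = q \<bullet> q in
     (D 0 s *\<^sub>R q,
      inverse (D 0 s) *\<^sub>R p -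
        (2 * D 1 s * inverse (D 0 s) * inverse (D 0 s + 2 * s * D 1 s) * (q \<bullet> p)) *\<^sub>R q))"

text \<open>The derivative of the radial map at \<open>q\<close> in direction
  \<open>w\<close>.\<close>

definition jac :: "'a::euclidean_space \<Rightarrow> 'a \<Rightarrow> 'a" where
  "jac q w = D 0 (q \<bullet> q) *\<^sub>R w + (2 * D 1 (q \<bullet> q) * (q \<bullet> w)) *\<^sub>R q"

lemma inner_self_less: "norm q < r \<Longrightarrow> q \<bullet> q < r\<^sup>2"
  by (metis norm_ge_zero power2_norm_eq_inner power_strict_mono zero_less_numeral)

text \<open>Characterises the fibre component implicitly, which is how the later arguments use it in
  place of its explicit formula.\<close>

lemma jac_snd_lift:
  assumes "norm (fst x) < r"
  shows "jac (fst x) (snd (lift x)) = snd x"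
proof -
  obtain q p where x: "x = (q, p)" by fastforce
  define s where "s = q \<bullet> q"
  have "s < r\<^sup>2" using assms x by (simp add: s_def inner_self_less)
  then have g: "D 0 s \<noteq> 0" and w: "D 0 s + 2 * s * D 1 s \<noteq> 0"
    using D0_pos speed_pos by force+
  define A where "A = D 0 s"
  define B where "B = D 1 s"
  define W where "W = A + 2 * s * B"
  have nz: "A \<noteq> 0" "W \<noteq> 0" using g w by (auto simp: A_def B_def W_def)
  define c where "c = 2 * B * inverse A * inverse W * (q \<bullet> p)"
  have L: "snd (lift x) = inverse A *\<^sub>R p - c *\<^sub>R q"
    by (simp add: lift_def x Let_def s_def A_def B_def W_def c_def)
  have "jac q (inverse A *\<^sub>R p - c *\<^sub>R q)
     = p + (2 * B * (inverse A * (q \<bullet> p) - c * s) - A * c) *\<^sub>R q"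
    using nz by (simp add: jac_def A_def[symmetric] B_def[symmetric] s_def[symmetric]
        inner_diff_right algebra_simps del: One_nat_def)
  \<comment> \<open>Collecting the terms in \<open>c\<close> produces the radial singular value
    \<open>W\<close>, which cancels against the factor \<open>inverse W\<close> in
    \<open>c\<close>.\<close>
  also have "2 * B * (inverse A * (q \<bullet> p) - c * s) - A * c = 2 * B * inverse A * (q \<bullet> p) - c * W"
    by (simp add: W_def algebra_simps)
  also have "\<dots> = 0" using nz by (simp add: c_def)
  finally show ?thesis using L x by simp
qed

text \<open>Only inner products, the functions \<open>D n\<close> at |q|^2 and reciprocals of two
  positive functions occur. The norm itself does not, so q = 0 is no special case.\<close>

lemma smooth_on_lift:
  fixes U :: "('a::euclidean_space \<times> 'a) set"
  assumes U: "open U" "\<And>x. x \<in> U \<Longrightarrow> norm (fst x) < r"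
  shows "smooth_on U lift"
  unfolding smooth_on_def
proof
  fix k
  have fst: "Ck_on k U fst" and snd: "Ck_on k U snd"
    using U(1) by (auto intro: Ck_on_bounded_linear bounded_linear_fst bounded_linear_snd)
  have s: "Ck_on k U (\<lambda>x. fst x \<bullet> fst x)"
    using Ck_on_inner[OF U(1) fst fst] .
  have D: "Ck_on k U (\<lambda>x. D n (fst x \<bullet> fst x))" for n
    by (rule Ck_on_compose_real[OF U(1) s, where T = "{..<r\<^sup>2}"])
      (use inner_self_less[OF U(2)] deriv in auto)
  have W: "Ck_on k U (\<lambda>x. D 0 (fst x \<bullet> fst x) + 2 * (fst x \<bullet> fst x) * D 1 (fst x \<bullet> fst x))"
    by (intro Ck_on_add Ck_on_mult U(1) Ck_on_const s D)
  have iD: "Ck_on k U (\<lambda>x. inverse (D 0 (fst x \<bullet> fst x)))"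
    by (rule Ck_on_inverse[OF U(1) D]) (rule D0_pos[OF inner_self_less[OF U(2)]])
  have iW: "Ck_on k U (\<lambda>x. inverse (D 0 (fst x \<bullet> fst x) + 2 * (fst x \<bullet> fst x) * D 1 (fst x \<bullet> fst x)))"
    by (rule Ck_on_inverse[OF U(1) W]) (rule speed_pos[OF inner_self_less[OF U(2)]])
  show "Ck_on k U lift"
    unfolding lift_def[abs_def] Let_def
    by (intro Ck_on_Pair Ck_on_diff Ck_on_scaleR Ck_on_mult Ck_on_inner U(1) Ck_on_const fst snd D iD iW)
qed

text \<open>Differentiating \<open>jac q P = p\<close> avoids the derivative of the inverse matrix: in the two-form, what
  remains besides \<open>\<omega>\<close> is the antisymmetrised second derivative of the radial map, which vanishes.\<close>

lemma lift_symplectic: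
  assumes x: "norm (fst x) < r" and L: "(lift has_derivative L) (at x)"
  shows "fst (L u) \<bullet> snd (L v) - fst (L v) \<bullet> snd (L u) = fst u \<bullet> snd v - fst v \<bullet> snd u"
proof -
  define q where "q = fst x"
  define P where "P = snd (lift x)"
  define A where "A = D 0 (q \<bullet> q)"
  define B where "B = D 1 (q \<bullet> q)"
  define C where "C = D 2 (q \<bullet> q)"
  have s: "q \<bullet> q < r\<^sup>2" using inner_self_less x q_def by blast
  have dfst: "(fst has_derivative fst) (at x)"
    by (simp add: bounded_linear_fst bounded_linear_imp_has_derivative)
  have ds: "((\<lambda>x. fst x \<bullet> fst x) has_derivative (\<lambda>u. 2 * (q \<bullet> fst u))) (at x)"
    using has_derivative_inner[OF dfst dfst] by (simp add: q_def inner_commute)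
  have dD: "((\<lambda>x. D n (fst x \<bullet> fst x)) has_derivative (\<lambda>u. D (Suc n) (q \<bullet> q) * (2 * (q \<bullet> fst u)))) (at x)" for n
    using has_derivative_compose[OF ds[unfolded q_def] deriv[OF s[unfolded q_def], unfolded has_field_derivative_def]]
    by (simp add: q_def)
  have dA: "((\<lambda>x. D 0 (fst x \<bullet> fst x)) has_derivative (\<lambda>u. B * (2 * (q \<bullet> fst u)))) (at x)"
    using dD[of 0] by (simp add: B_def)
  have dB: "((\<lambda>x. D 1 (fst x \<bullet> fst x)) has_derivative (\<lambda>u. C * (2 * (q \<bullet> fst u)))) (at x)"
    using dD[of 1] by (simp add: C_def numeral_2_eq_2)
  have dP: "((\<lambda>x. snd (lift x)) has_derivative (\<lambda>u. snd (L u))) (at x)"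
    using has_derivative_snd[OF L] .
  have "((\<lambda>x. D 0 (fst x \<bullet> fst x) *\<^sub>R fst x) has_derivative (\<lambda>u. jac q (fst u))) (at x)"
    by (rule has_derivative_eq_rhs[OF has_derivative_scaleR[OF dA dfst]])
      (simp add: fun_eq_iff jac_def A_def B_def q_def algebra_simps)
  moreover have "((\<lambda>x. D 0 (fst x \<bullet> fst x) *\<^sub>R fst x) has_derivative (\<lambda>u. fst (L u))) (at x)"
    using has_derivative_fst[OF L] by (simp add: lift_def Let_def)
  ultimately have Lq: "fst (L u) = jac q (fst u)" for u
    using has_derivative_unique by metis
  have "((\<lambda>x. D 0 (fst x \<bullet> fst x) *\<^sub>R snd (lift x) + (2 * D 1 (fst x \<bullet> fst x) * (fst x \<bullet> snd (lift x))) *\<^sub>R fst x)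
     has_derivative (\<lambda>u. jac q (snd (L u)) + (2 * B * (q \<bullet> fst u)) *\<^sub>R P
        + (4 * C * (q \<bullet> fst u) * (q \<bullet> P)) *\<^sub>R q + (2 * B * (fst u \<bullet> P)) *\<^sub>R q
        + (2 * B * (q \<bullet> P)) *\<^sub>R fst u)) (at x)"
    by (rule has_derivative_eq_rhs[OF has_derivative_add[OF has_derivative_scaleR[OF dA dP]
          has_derivative_scaleR[OF has_derivative_mult[OF has_derivative_mult[OF has_derivative_const dB]
            has_derivative_inner[OF dfst dP]] dfst]]])
      (simp add: fun_eq_iff jac_def q_def[symmetric] P_def[symmetric] A_def[symmetric] B_def[symmetric]
          C_def[symmetric] algebra_simps del: One_nat_def)
  \<comment> \<open>On the open set |q| < r the function just differentiated equals
    \<open>snd\<close>. Uniqueness of derivatives then expresses \<open>snd u\<close> through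
    \<open>L u\<close>.\<close>
  then have "(snd has_derivative (\<lambda>u. jac q (snd (L u)) + (2 * B * (q \<bullet> fst u)) *\<^sub>R P
        + (4 * C * (q \<bullet> fst u) * (q \<bullet> P)) *\<^sub>R q + (2 * B * (fst u \<bullet> P)) *\<^sub>R q
        + (2 * B * (q \<bullet> P)) *\<^sub>R fst u)) (at x)"
  proof (rule has_derivative_transform_within_open[where s = "{y. norm (fst y) < r}"])
    show "open {y :: 'a \<times> 'a. norm (fst y) < r}"
      by (intro open_Collect_less continuous_intros)
    show "D 0 (fst y \<bullet> fst y) *\<^sub>R snd (lift y) + (2 * D 1 (fst y \<bullet> fst y) * (fst y \<bullet> snd (lift y))) *\<^sub>R fst y = snd y"
      if "y \<in> {y. norm (fst y) < r}" for y :: "'a \<times> 'a"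
      using jac_snd_lift[of y] that by (simp add: jac_def)
  qed (use x in simp)
  from fun_cong[OF has_derivative_unique[OF bounded_linear_imp_has_derivative[OF bounded_linear_snd] this]]
  have Lp: "snd u = jac q (snd (L u)) + (2 * B * (q \<bullet> fst u)) *\<^sub>R P
        + (4 * C * (q \<bullet> fst u) * (q \<bullet> P)) *\<^sub>R q + (2 * B * (fst u \<bullet> P)) *\<^sub>R q
        + (2 * B * (q \<bullet> P)) *\<^sub>R fst u" for u
    .
  have sym: "jac q v \<bullet> w = v \<bullet> jac q w" for v w
    by (simp add: jac_def inner_add_left inner_add_right inner_commute algebra_simps)
  have "w \<bullet> snd u = w \<bullet> jac q (snd (L u)) + (2 * B * (q \<bullet> fst u)) * (w \<bullet> P)
        + (4 * C * (q \<bullet> fst u) * (q \<bullet> P)) * (w \<bullet> q) + (2 * B * (fst u \<bullet> P)) * (w \<bullet> q)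
        + (2 * B * (q \<bullet> P)) * (w \<bullet> fst u)" for w u
    by (subst Lp) (simp only: inner_add_right inner_scaleR_right)
  \<comment> \<open>Upon exchanging \<open>u\<close> and \<open>v\<close>, the first and third
    correction terms swap and the other two are unchanged. All four cancel in the difference,
    leaving only the \<open>jac\<close> terms.\<close>
  from this[of "fst u" v] this[of "fst v" u]
  have "fst u \<bullet> snd v - fst v \<bullet> snd u = fst u \<bullet> jac q (snd (L v)) - fst v \<bullet> jac q (snd (L u))"
    by (simp add: inner_commute algebra_simps)
  then show ?thesis by (simp add: Lq sym)
qed

section \<open>Injectivity and norm bounds for the lift\<close>

text \<open>The function t G(t^2) is the radial profile F, and its derivative is the radial singular
  value.\<close>

lemma radius_has_derivative:
  assumes "\<bar>t\<bar> < r"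
  shows "((\<lambda>t. t * D 0 (t\<^sup>2)) has_real_derivative (D 0 (t\<^sup>2) + 2 * t\<^sup>2 * D 1 (t\<^sup>2))) (at t)"
proof -
  have "t\<^sup>2 < r\<^sup>2" using assms by (metis abs_ge_zero power2_abs power_strict_mono zero_less_numeral)
  moreover have "((\<lambda>t. t\<^sup>2) has_real_derivative 2 * t) (at t)"
    by (auto intro!: derivative_eq_intros)
  ultimately have "((\<lambda>t. D 0 (t\<^sup>2)) has_real_derivative (D 1 (t\<^sup>2) * (2 * t))) (at t)"
    using DERIV_chain2[where f = "D 0" and g = "\<lambda>t. t\<^sup>2", OF deriv] by simp
  then show ?thesis
    by (auto intro!: derivative_eq_intros simp: power2_eq_square)
qed

text \<open>The profile F is strictly increasing, so the length of phi q determines |q|, hence the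
  scalar in front of \<open>q\<close>, hence \<open>q\<close>. The invertible Jacobian at
  \<open>q\<close> then recovers \<open>p\<close>.\<close>

lemma inj_on_lift: "inj_on lift {x. norm (fst x) < r}"
proof (rule inj_onI)
  fix x y assume x: "x \<in> {x. norm (fst x) < r}" and y: "y \<in> {x. norm (fst x) < r}"
    and eq: "lift x = lift y"
  have mono: "t * D 0 (t\<^sup>2) < t' * D 0 (t'\<^sup>2)" if "0 \<le> t" "t < t'" "t' < r" for t t'
  proof (rule DERIV_pos_imp_increasing[OF that(2)])
    fix z assume "t \<le> z" "z \<le> t'"
    then have z: "\<bar>z\<bar> < r" using that by auto
    then have "z\<^sup>2 < r\<^sup>2" by (metis abs_ge_zero power2_abs power_strict_mono zero_less_numeral)
    then show "\<exists>d. ((\<lambda>t. t * D 0 (t\<^sup>2)) has_real_derivative d) (at z) \<and> 0 < d"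
      using radius_has_derivative[OF z] speed_pos by blast
  qed
  have q: "D 0 (fst x \<bullet> fst x) *\<^sub>R fst x = D 0 (fst y \<bullet> fst y) *\<^sub>R fst y"
    using arg_cong[OF eq, of fst] by (simp add: lift_def Let_def)
  have pos: "D 0 (fst x \<bullet> fst x) > 0" "D 0 (fst y \<bullet> fst y) > 0"
    using x y D0_pos inner_self_less by auto
  have "norm (fst x) * D 0 ((norm (fst x))\<^sup>2) = norm (fst y) * D 0 ((norm (fst y))\<^sup>2)"
    using arg_cong[OF q, of norm] pos by (simp add: power2_norm_eq_inner mult.commute)
  then have "norm (fst x) = norm (fst y)"
    using mono[of "norm (fst x)" "norm (fst y)"] mono[of "norm (fst y)" "norm (fst x)"] x y
    by (metis less_irrefl linorder_less_linear mem_Collect_eq norm_ge_zero)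
  then have "fst x \<bullet> fst x = fst y \<bullet> fst y"
    by (metis power2_norm_eq_inner)
  then have "fst x = fst y" using q pos by simp
  moreover have "snd x = snd y"
    using jac_snd_lift[of x] jac_snd_lift[of y] x y eq \<open>fst x = fst y\<close> by simp
  ultimately show "x = y" by (simp add: prod_eq_iff)
qed

lemma norm_fst_lift:
  assumes "norm (fst x) < r"
  shows "norm (fst (lift x)) = norm (fst x) * D 0 ((norm (fst x))\<^sup>2)"
  using D0_pos[OF inner_self_less[OF assms]]
  by (simp add: lift_def Let_def power2_norm_eq_inner)

text \<open>If the radial profile is concave, the radial derivative is the smallest singular value.\<close>

lemma norm_snd_lift:
  assumes x: "norm (fst x) < r" and concave: "D 1 (fst x \<bullet> fst x) \<le> 0"
  shows "(D 0 (fst x \<bullet> fst x) + 2 * (fst x \<bullet> fst x) * D 1 (fst x \<bullet> fst x)) * norm (snd (lift x)) \<le> norm (snd x)"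
proof -
  define q where "q = fst x"
  define P where "P = snd (lift x)"
  define s where "s = q \<bullet> q"
  define A where "A = D 0 s"
  define B where "B = D 1 s"
  have W: "A + 2 * s * B > 0" "B \<le> 0" "s \<ge> 0"
    using speed_pos[OF inner_self_less[OF x]] concave by (auto simp: A_def B_def s_def q_def)
  then have "s * B \<le> 0" by (simp add: mult_nonneg_nonpos)
  with W have "A + s * B \<ge> 0" by linarith
  moreover have "(q \<bullet> P)\<^sup>2 \<le> s * (P \<bullet> P)"
    using Cauchy_Schwarz_ineq[of q P] by (simp add: s_def)
  \<comment> \<open>This product is exactly the excess of |jac q P|^2 over the square of the radial
    singular value times |P|^2; it vanishes when \<open>P\<close> is parallel to
    \<open>q\<close>.\<close>
  ultimately have "0 \<le> 4 * (- B) * (A + s * B) * (s * (P \<bullet> P) - (q \<bullet> P)\<^sup>2)"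
    using W(2) by (intro mult_nonneg_nonneg) auto
  also have "\<dots> = jac q P \<bullet> jac q P - (A + 2 * s * B)\<^sup>2 * (P \<bullet> P)"
    by (simp add: jac_def s_def[symmetric] A_def[symmetric] B_def[symmetric] inner_add_left inner_add_right
        inner_commute[of P q] power2_eq_square algebra_simps del: One_nat_def)
  finally have "((A + 2 * s * B) * norm P)\<^sup>2 \<le> (norm (jac q P))\<^sup>2"
    by (simp add: power_mult_distrib power2_norm_eq_inner)
  then have "(A + 2 * s * B) * norm P \<le> norm (jac q P)"
    using power2_le_imp_le norm_ge_zero by blast
  then show ?thesis
    using jac_snd_lift[OF x] by (simp add: q_def P_def s_def A_def B_def)
qed

end

section \<open>The radial profile\<close>

text \<open>The \<open>n\<close>-th derivative in \<open>s\<close> of G(s) = (integral over t in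
  [0, 1] of sqrt (r^2 - s t^2)) / b, taken under the integral sign; each differentiation brings out
  a factor -t^2.\<close>

definition profile :: "real \<Rightarrow> real \<Rightarrow> nat \<Rightarrow> real \<Rightarrow> real" where
  "profile b r n s = integral {0..1} (\<lambda>t. (- (t\<^sup>2)) ^ n * powr_deriv (1/2) n (r\<^sup>2 - s * t\<^sup>2)) / b"

text \<open>Keeps the powers away from their singularity at 0, so that all integrands are continuous
  up to t = 1.\<close>

lemma profile_arg_pos:
  fixes r s t :: real
  assumes "r > 0" "s < r\<^sup>2" "t \<in> {0..1}"
  shows "r\<^sup>2 - s * t\<^sup>2 > 0"
proof (cases "s \<le> 0")
  case True
  then have "s * t\<^sup>2 \<le> 0" by (simp add: mult_nonpos_nonneg)
  then show ?thesis using assms(1) by (smt (verit) zero_less_power)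
next
  case False
  then have "s * t\<^sup>2 \<le> s * 1" using assms(3) by (intro mult_left_mono) (auto simp: power_le_one)
  then show ?thesis using assms by simp
qed

lemma continuous_on_profile_integrand:
  assumes "r > 0"
  shows "continuous_on ({..<r\<^sup>2} \<times> {0..1})
    (\<lambda>(s, t). (- (t\<^sup>2)) ^ n * powr_deriv \<alpha> n (r\<^sup>2 - s * t\<^sup>2))"
  unfolding powr_deriv_def case_prod_beta
  by (intro continuous_intros) (use profile_arg_pos[OF assms] in force)

lemma integrable_profile_integrand:
  assumes "r > 0" "s < r\<^sup>2"
  shows "(\<lambda>t. (- (t\<^sup>2)) ^ n * powr_deriv \<alpha> n (r\<^sup>2 - s * t\<^sup>2)) integrable_on {0..1}"
proof (rule integrable_continuous_real)
  show "continuous_on {0..1} (\<lambda>t. (- (t\<^sup>2)) ^ n * powr_deriv \<alpha> n (r\<^sup>2 - s * t\<^sup>2))"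
    using continuous_on_compose2[OF continuous_on_profile_integrand[OF assms(1), of n \<alpha>],
        of "{0..1}" "\<lambda>t. (s, t)"] assms(2)
    by (force intro: continuous_intros)
qed

text \<open>Leibniz rule: the \<open>s\<close>-derivative of the integrand is jointly continuous in
  \<open>s\<close> and \<open>t\<close>.\<close>

lemma profile_has_derivative:
  assumes "r > 0" "s < r\<^sup>2"
  shows "(profile b r n has_real_derivative profile b r (Suc n) s) (at s)"
proof -
  let ?f = "\<lambda>n s t. (- (t\<^sup>2)) ^ n * powr_deriv (1/2) n (r\<^sup>2 - s * t\<^sup>2)"
  have "((\<lambda>s. integral (cbox 0 1) (?f n s)) has_field_derivative integral (cbox 0 1) (?f (Suc n) s))
      (at s within {..<r\<^sup>2})"
  proof (rule leibniz_rule_field_derivative)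
    fix z t :: real assume z: "z \<in> {..<r\<^sup>2}" and t: "t \<in> cbox 0 1"
    have "r\<^sup>2 - z * t\<^sup>2 > 0" using profile_arg_pos[OF assms(1)] z t by auto
    moreover have "((\<lambda>z. r\<^sup>2 - z * t\<^sup>2) has_real_derivative - t\<^sup>2) (at z)"
      by (auto intro!: derivative_eq_intros)
    ultimately have "((\<lambda>z. powr_deriv (1/2) n (r\<^sup>2 - z * t\<^sup>2)) has_real_derivative
        powr_deriv (1/2) (Suc n) (r\<^sup>2 - z * t\<^sup>2) * (- t\<^sup>2)) (at z)"
      by (intro DERIV_chain2[where g = "\<lambda>z. r\<^sup>2 - z * t\<^sup>2"] powr_deriv_has_derivative)
    from DERIV_cmult[OF this, of "(- (t\<^sup>2)) ^ n"]
    show "((\<lambda>z. ?f n z t) has_field_derivative ?f (Suc n) z t) (at z within {..<r\<^sup>2})"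
      by (simp add: has_field_derivative_at_within mult.assoc mult.left_commute mult.commute)
  qed (use assms integrable_profile_integrand[OF assms(1)]
        continuous_on_profile_integrand[OF assms(1), of "Suc n"] in auto)
  then have "((\<lambda>s. integral {0..1} (?f n s)) has_real_derivative integral {0..1} (?f (Suc n) s)) (at s)"
    using assms(2) by (simp add: at_within_open[of s "{..<r\<^sup>2}"])
  then show ?thesis
    unfolding profile_def[abs_def] by (rule DERIV_cdivide)
qed

lemma profile_0_pos:
  assumes "b > 0" "r > 0" "s < r\<^sup>2"
  shows "profile b r 0 s > 0"
proof -
  let ?f = "\<lambda>t. (r\<^sup>2 - s * t\<^sup>2) powr (1/2)"
  have pos: "r\<^sup>2 - s * t\<^sup>2 \<noteq> 0" if "t \<in> {0..1}" for t
    using profile_arg_pos[OF assms(2,3) that] by simp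
  have "integral {0..1} (\<lambda>t::real. 0) < integral {0..1} ?f"
    by (rule integral_less_real) (use pos in \<open>auto intro!: continuous_intros\<close>)
  then show ?thesis
    using assms(1) by (simp add: profile_def powr_deriv_def)
qed

text \<open>The integrand is -t^2 / (2 sqrt (r^2 - s t^2)). The sign makes the radial singular value
  the smaller one for s \<ge> 0.\<close>

lemma profile_1_nonpos:
  assumes "b > 0" "r > 0" "s < r\<^sup>2"
  shows "profile b r 1 s \<le> 0"
proof -
  have "integral {0..1} (\<lambda>t. (- (t\<^sup>2)) ^ 1 * powr_deriv (1/2) 1 (r\<^sup>2 - s * t\<^sup>2)) \<le> 0"
    using integral_le[OF integrable_profile_integrand[OF assms(2,3), of 1 "1/2"] integrable_0]
    by (simp add: powr_deriv_def)
  then show ?thesis using assms(1) by (simp add: profile_def divide_nonpos_pos)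
qed

text \<open>The combined integrand is the \<open>t\<close>-derivative of t sqrt (r^2 - s t^2), so
  the integral is the value at t = 1. With s = t^2 this is the prescribed F'(t).\<close>

lemma profile_speed:
  assumes "r > 0" "s < r\<^sup>2"
  shows "profile b r 0 s + 2 * s * profile b r 1 s = sqrt (r\<^sup>2 - s) / b"
proof -
  let ?f = "\<lambda>n t. (- (t\<^sup>2)) ^ n * powr_deriv (1/2) n (r\<^sup>2 - s * t\<^sup>2)"
  have I: "((\<lambda>t. ?f 0 t + 2 * s * ?f 1 t) has_integral
      1 * sqrt (r\<^sup>2 - s * 1\<^sup>2) - 0 * sqrt (r\<^sup>2 - s * 0\<^sup>2)) {0..1}"
  proof (rule fundamental_theorem_of_calculus)
    fix t :: real assume t: "t \<in> {0..1}"
    have pos: "r\<^sup>2 - s * t\<^sup>2 > 0" using profile_arg_pos[OF assms t] .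
    then have "((\<lambda>t. t * sqrt (r\<^sup>2 - s * t\<^sup>2)) has_real_derivative
       sqrt (r\<^sup>2 - s * t\<^sup>2) - s * t\<^sup>2 / sqrt (r\<^sup>2 - s * t\<^sup>2)) (at t)"
      by (auto intro!: derivative_eq_intros simp: field_simps power2_eq_square)
    moreover have "?f 0 t + 2 * s * ?f 1 t = sqrt (r\<^sup>2 - s * t\<^sup>2) - s * t\<^sup>2 / sqrt (r\<^sup>2 - s * t\<^sup>2)"
      using pos by (simp add: powr_deriv_def powr_half_sqrt powr_minus_divide)
    ultimately show "((\<lambda>t. t * sqrt (r\<^sup>2 - s * t\<^sup>2)) has_vector_derivative ?f 0 t + 2 * s * ?f 1 t)
        (at t within {0..1})"
      by (simp only: has_real_derivative_iff_has_vector_derivative has_vector_derivative_at_within)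
  qed simp
  have J: "((\<lambda>t. ?f 0 t + 2 * s * ?f 1 t) has_integral
      integral {0..1} (?f 0) + 2 * s * integral {0..1} (?f 1)) {0..1}"
    by (intro has_integral_add has_integral_mult_right integrable_integral
        integrable_profile_integrand[OF assms])
  have "integral {0..1} (?f 0) + 2 * s * integral {0..1} (?f 1) = sqrt (r\<^sup>2 - s)"
    using has_integral_unique[OF J I]
    by (simp only: one_power2 mult_1 mult_1_right mult_zero_left diff_zero)
  then show ?thesis
    by (simp only: profile_def times_divide_eq_right flip: add_divide_distrib)
qed

text \<open>F has an elementary form \<open>H\<close>, the area under a circular arc of radius
  \<open>r\<close> divided by \<open>b\<close>. It increases strictly to the quarter-disc area over
  \<open>b\<close>.\<close>

lemma profile_radius_less:
  assumes "b > 0" "r > 0" "0 \<le> t" "t < r"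
  shows "t * profile b r 0 (t\<^sup>2) < pi * r\<^sup>2 / (4 * b)"
proof -
  interpret radial_map "profile b r" r
    using assms profile_has_derivative profile_0_pos profile_speed
    by unfold_locales auto
  define H where "H t = (t * sqrt (r\<^sup>2 - t\<^sup>2) + r\<^sup>2 * arcsin (t / r)) / (2 * b)" for t
  have lt: "z\<^sup>2 < r\<^sup>2" if "\<bar>z\<bar> < r" for z
    using that by (metis abs_ge_zero power2_abs power_strict_mono zero_less_numeral)
  have H: "(H has_real_derivative sqrt (r\<^sup>2 - z\<^sup>2) / b) (at z)" if z: "\<bar>z\<bar> < r" for z
  proof -
    define w where "w = sqrt (r\<^sup>2 - z\<^sup>2)"
    have w: "w > 0" "r\<^sup>2 = w\<^sup>2 + z\<^sup>2" using lt[OF z] by (auto simp: w_def)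
    have "sqrt (1 - (z / r)\<^sup>2) = w / r"
    proof (rule real_sqrt_unique)
      show "(w / r)\<^sup>2 = 1 - (z / r)\<^sup>2"
        using w assms(2) by (simp add: power_divide divide_simps)
    qed (use w(1) assms(2) in simp)
    moreover have "- 1 < z / r" "z / r < 1" using z assms(2) by (auto simp: field_simps)
    ultimately have a: "((\<lambda>z. arcsin (z / r)) has_real_derivative 1 / w) (at z)"
      using DERIV_chain2[where g = "\<lambda>z. z / r", OF DERIV_arcsin, of z "1 / r"] assms(2)
      by (auto intro!: derivative_eq_intros simp: field_simps)
    have b: "((\<lambda>z. sqrt (r\<^sup>2 - z\<^sup>2)) has_real_derivative - z / w) (at z)"
      using lt[OF z] by (auto intro!: derivative_eq_intros simp: w_def field_simps)
    have "(H has_real_derivative (1 * sqrt (r\<^sup>2 - z\<^sup>2) + - z / w * z + r\<^sup>2 * (1 / w)) / (2 * b)) (at z)"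
      unfolding H_def[abs_def]
      by (intro DERIV_cdivide DERIV_add DERIV_mult DERIV_ident DERIV_cmult a b)
    moreover have "(1 * sqrt (r\<^sup>2 - z\<^sup>2) + - z / w * z + r\<^sup>2 * (1 / w)) / (2 * b) = w / b"
      unfolding w_def[symmetric] w(2) using w(1) assms(1) by (simp add: field_simps power2_eq_square)
    ultimately show ?thesis by (simp add: w_def)
  qed
  \<comment> \<open>F and \<open>H\<close> have the same derivative on [0, t], so their difference
    is constant there.\<close>
  have "(\<lambda>t. t * profile b r 0 (t\<^sup>2) - H t) t = (\<lambda>t. t * profile b r 0 (t\<^sup>2) - H t) 0"
  proof (cases "t = 0")
    case False
    have d: "((\<lambda>t. t * profile b r 0 (t\<^sup>2) - H t) has_real_derivative 0) (at z)" if "0 \<le> z" "z \<le> t" for z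
    proof -
      have z: "\<bar>z\<bar> < r" using that assms by auto
      from DERIV_diff[OF radius_has_derivative[OF z] H[OF z]] show ?thesis
        using profile_speed[OF assms(2) lt[OF z]] by simp
    qed
    show ?thesis
      by (rule DERIV_isconst2[of 0 t]) (use False assms d in \<open>auto intro!: DERIV_atLeastAtMost_imp_continuous_on\<close>)
  qed simp
  then have "t * profile b r 0 (t\<^sup>2) = H t" by (simp add: H_def)
  also have "H t < H r"
  \<comment> \<open>The derivative of \<open>H\<close> is available only inside |z| < r; continuity
    covers the endpoint \<open>r\<close>.\<close>
  proof (rule DERIV_pos_imp_increasing_open[OF assms(4)])
    fix z assume "t < z" "z < r"
    then have "\<bar>z\<bar> < r" using assms(3) by auto
    then show "\<exists>y. (H has_real_derivative y) (at z) \<and> 0 < y"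
      using H lt assms(1) by (intro exI[of _ "sqrt (r\<^sup>2 - z\<^sup>2) / b"]) auto
  next
    show "continuous_on {t..r} H"
      unfolding H_def[abs_def] using assms
      by (intro continuous_intros) (auto simp: field_simps)
  qed
  also have "H r = pi * r\<^sup>2 / (4 * b)" using assms by (simp add: H_def)
  finally show ?thesis .
qed

section \<open>Nondegeneracy of the symplectic form, and the embedding of the ball\<close>

lemma omega_st_inner: "omega_st u v = fst u \<bullet> snd v - fst v \<bullet> snd u"
  by (simp add: omega_st_def inner_vec_def sum_subtractf)

text \<open>Nondegeneracy: pairing \<open>u\<close> with its rotation
  \<open>(- snd u, fst u)\<close> gives |u|^2, which must vanish if \<open>L u = 0\<close>.\<close>

lemma inj_if_preserves_omega_st:
  assumes "linear L" and "\<And>u v. omega_st (L u) (L v) = omega_st u v"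
  shows "inj L"
proof -
  have "u = 0" if "L u = 0" for u
  proof -
    have "omega_st u (- snd u, fst u) = 0"
      using assms(2)[of u "(- snd u, fst u)"] that by (simp add: omega_st_inner)
    then have "fst u \<bullet> fst u + snd u \<bullet> snd u = 0" by (simp add: omega_st_inner)
    then show "u = 0"
      by (metis inner_eq_zero_iff inner_prod_def)
  qed
  then show ?thesis using assms(1) linear_injective_0 by blast
qed

theorem lemma3p7:
  fixes a b :: real
  assumes "a > 0" and "b > 0"
  shows "\<exists>e :: (real ^ 'n) \<times> (real ^ 'n) \<Rightarrow> (real ^ 'n) \<times> (real ^ 'n).
    relative_symplectic_embedding
      (ball 0 (2 * sqrt (a * b / pi)))
      (ball 0 (2 * sqrt (a * b / pi)) \<times> {0})
      (lagrangian_bidisc a b)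
      (disc_q a)
      e"
proof -
  define r where "r = 2 * sqrt (a * b / pi)"
  \<comment> \<open>The radius is chosen so that the supremum F(r), the quarter-disc area over
    \<open>b\<close>, is \<open>a\<close>.\<close>
  have r: "r > 0" "pi * r\<^sup>2 / (4 * b) = a" using assms by (auto simp: r_def power_mult_distrib)
  interpret radial_map "profile b r" r
    using assms r(1) profile_has_derivative profile_0_pos profile_speed
    by unfold_locales auto
  define U where "U = (ball 0 r :: ((real ^ 'n) \<times> (real ^ 'n)) set)"
  have U: "norm (fst x) < r" if "x \<in> U" for x
    using that norm_fst_le[of "fst x" "snd x"] by (simp add: U_def)
  have "open U" by (simp add: U_def)
  have smooth: "smooth_on U lift" using smooth_on_lift \<open>open U\<close> U by blast
  have der: "(lift has_derivative frechet_derivative lift (at x)) (at x)" if "x \<in> U" for x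
    using smooth that by (metis Ck_on_SucD(1) smooth_on_def)
  have omega: "omega_st (frechet_derivative lift (at x) u) (frechet_derivative lift (at x) v) = omega_st u v"
    if "x \<in> U" for x u v
    using lift_symplectic[OF U[OF that] der[OF that]] by (simp add: omega_st_inner)
  have inj: "inj (frechet_derivative lift (at x))" if "x \<in> U" for x
    using inj_if_preserves_omega_st[OF has_derivative_linear[OF der[OF that]]] omega[OF that] by blast
  have q: "norm (fst (lift x)) < a" if "x \<in> U" for x
    using profile_radius_less[OF assms(2) r(1) norm_ge_zero U[OF that]] norm_fst_lift[OF U[OF that]] r(2) by simp
  \<comment> \<open>In the ball |p| < sqrt (r^2 - |q|^2), while the smallest singular value is sqrt
    (r^2 - |q|^2) / b; their quotient is \<open>b\<close>.\<close>
  have p: "norm (snd (lift x)) < b" if "x \<in> U" for x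
  proof -
    define s where "s = fst x \<bullet> fst x"
    have s: "s < r\<^sup>2" using inner_self_less[OF U[OF that]] by (simp add: s_def)
    have "norm x < r" using that by (simp add: U_def)
    then have "(norm x)\<^sup>2 < r\<^sup>2" by (simp add: power_strict_mono)
    then have "(norm (snd x))\<^sup>2 < r\<^sup>2 - s"
      by (simp add: power2_norm_eq_inner inner_prod_def s_def)
    then have "norm (snd x) < sqrt (r\<^sup>2 - s)" by (simp add: real_less_rsqrt)
    moreover have "sqrt (r\<^sup>2 - s) / b * norm (snd (lift x)) \<le> norm (snd x)"
      using norm_snd_lift[OF U[OF that]] profile_1_nonpos[OF assms(2) r(1) s] profile_speed[OF r(1) s, of b]
      by (simp add: s_def)
    ultimately have "sqrt (r\<^sup>2 - s) / b * norm (snd (lift x)) < sqrt (r\<^sup>2 - s) / b * b"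
      using assms(2) by simp
    moreover have "sqrt (r\<^sup>2 - s) / b > 0" using s assms(2) by simp
    ultimately show ?thesis
      using mult_less_cancel_left_pos by blast
  qed
  have "continuous_on U lift" using smooth by (metis Ck_on.simps(1) smooth_on_def)
  moreover have "inj_on lift U" using inj_on_subset[OF inj_on_lift] U by blast
  \<comment> \<open>Source and target have the same dimension, so invariance of domain makes the
    inverse continuous.\<close>
  ultimately have "\<exists>g. homeomorphism U (lift ` U) lift g"
    using invariance_of_domain_homeomorphism[OF \<open>open U\<close>] by (metis order_refl)
  moreover have "open (lagrangian_bidisc a b :: ((real ^ 'n) \<times> (real ^ 'n)) set)"
  proof -
    have "lagrangian_bidisc a b = ball (0 :: real ^ 'n) a \<times> ball (0 :: real ^ 'n) b" by (auto simp: lagrangian_bidisc_def)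
    then show ?thesis by (simp add: open_Times)
  qed
  moreover have "lift ` U \<subseteq> lagrangian_bidisc a b"
    using q p by (simp add: lagrangian_bidisc_def image_subset_iff mem_Times_iff)
  ultimately have "symplectic_embedding U (lagrangian_bidisc a b) lift"
    using \<open>open U\<close> smooth inj omega
    by (simp add: symplectic_embedding_def smooth_embedding_def pullback2_def fun_eq_iff)
  moreover have "{x \<in> U. lift x \<in> disc_q a} = ball 0 r \<times> {0}"
  proof -
    \<comment> \<open>The fibre part is linear in \<open>p\<close> with inverse \<open>jac\<close>,
      so it vanishes only for p = 0. The condition |phi q| < a holds throughout the ball.\<close>
    have "snd (lift x) = 0 \<longleftrightarrow> snd x = 0" if "x \<in> U" for x
      using jac_snd_lift[OF U[OF that]] by (auto simp: jac_def lift_def Let_def)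
    moreover have "y \<in> disc_q a \<longleftrightarrow> norm (fst y) < a \<and> snd y = 0" for y :: "(real ^ 'n) \<times> (real ^ 'n)"
      by (cases y) (auto simp: disc_q_def)
    ultimately show ?thesis
      using q U by (auto simp: U_def norm_Pair)
  qed
  ultimately show ?thesis
    unfolding relative_symplectic_embedding_def r_def U_def by blast
qed

end
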